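(* Let $f(x,\lambda)$ be an irrationality measure, and let $\lambda>0$ be a fixed value such that $f(x,\lambda)=o(x^{-2})$ as $x\to\infty$. Suppose further that for any $\varepsilon>0$ there exists a positive constant $c=c(\varepsilon)<1$, independent of $x$, such that $f(x,\lambda+\varepsilon)<c\,f(x,\lambda)$ for all $x$ sufficiently large. Then there exists an irrational number $\theta_\lambda$ which has irrationality measure $f(x,\lambda)$ and is approximable to order $\omega(x)=f(x,\lambda)$.
   Context: An irrationality measure is a function $f(x,\lambda)$, defined for real $x\ge1$ and $\lambda>0$, which takes values in the positive reals and is strictly decreasing in both $x$ and $\lambda$. Let $\alpha$ be irrational. If there exists $\lambda>0$ with the property that for any $\varepsilon>0$ there is a positive integer $q(\varepsilon)$ such that $\left|\alpha-\frac pq\right|>f(q,\lambda+\varepsilon)$ for all integers $p,q$ with $q\ge q(\varepsilon)$, then $\lambda(\alpha)$ denotes the least such $\lambda$, and $\alpha$ is said to have irrationality measure $f(x,\lambda(\alpha))$. Thus "$\alpha$ has irrationality measure $f(x,\lambda)$" for a given $\lambda$ means that $\lambda(\alpha)=\lambda$. If no such $\lambda$ exists, $\lambda(\alpha)=\infty$. Given a real number $\theta$ and a positive real-valued function $\omega(x)$ defined for $x\ge1$, $\theta$ is approximable to order $\omega$ if for every $C>0$ there exists a pair of integers $p,q$, with $q>C$, such that $\left|\theta-\frac pq\right|<\omega(q)$. *)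

theory Defs
  imports Complex_Main "HOL-Library.Landau_Symbols"
begin

text \<open>
  The functions \<open>f\<close> and \<open>\<omega>\<close> below are total in Isabelle/HOL; only their values at
  \<open>x \<ge> 1\<close> (and \<open>l > 0\<close>) are ever constrained or used.
\<close>

definition irrationality_measure :: "(real \<Rightarrow> real \<Rightarrow> real) \<Rightarrow> bool" where
  "irrationality_measure f \<longleftrightarrow>
     (\<forall>x\<ge>1. \<forall>l>0. f x l > 0) \<and>
     (\<forall>l>0. strict_antimono_on {1..} (\<lambda>x. f x l)) \<and>
     (\<forall>x\<ge>1. strict_antimono_on {0<..} (\<lambda>l. f x l))"

definition admissible_parameters :: "(real \<Rightarrow> real \<Rightarrow> real) \<Rightarrow> real \<Rightarrow> real set" where
  "admissible_parameters f \<alpha> =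
     {l. l > 0 \<and>
         (\<forall>\<epsilon>>0. \<exists>q0::int. q0 > 0 \<and>
            (\<forall>p q :: int. q \<ge> q0 \<longrightarrow>
               \<bar>\<alpha> - real_of_int p / real_of_int q\<bar> > f (real_of_int q) (l + \<epsilon>)))}"

text \<open>
  The value \<open>\<lambda>(\<alpha>)\<close> is the least admissible parameter. Being a least element is expressed as a
  relation, since a description operator would yield an arbitrary value when there is none
  (no admissible parameter, or arbitrarily small positive ones).
\<close>

definition has_irrationality_measure :: "real \<Rightarrow> (real \<Rightarrow> real \<Rightarrow> real) \<Rightarrow> real \<Rightarrow> bool" where
  "has_irrationality_measure \<alpha> f l \<longleftrightarrow>
     \<alpha> \<notin> \<rat> \<and> l \<in> admissible_parameters f \<alpha> \<and> (\<forall>m\<in>admissible_parameters f \<alpha>. l \<le> m)"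

definition approximable_to_order :: "real \<Rightarrow> (real \<Rightarrow> real) \<Rightarrow> bool" where
  "approximable_to_order \<theta> \<omega> \<longleftrightarrow>
     (\<forall>C::real. C > 0 \<longrightarrow>
        (\<exists>p q :: int. real_of_int q > C \<and>
           \<bar>\<theta> - real_of_int p / real_of_int q\<bar> < \<omega> (real_of_int q)))"

end

theory Submission imports Defs begin

text \<open>
  Write \<open>g(x) = f(x, \<lambda>)\<close>. The number \<open>\<theta>\<close> is the limit of an increasing sequence \<open>P n / Q n\<close>
  with consecutive determinants \<open>1\<close>, so that \<open>\<theta> - P n / Q n\<close> lies between \<open>1 / (Q n * Q (n+1))\<close>
  and \<open>1 / (Q n * (Q (n+1) - Q n))\<close>. By Bezout, \<open>Q (n+1)\<close> can be prescribed up to an error \<open>Q n\<close>,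
  which is negligible against \<open>1 / (Q n * g (Q n))\<close> because \<open>g(x) = o(x\<^sup>-\<^sup>2)\<close>; hence
  \<open>\<theta> - P n / Q n\<close> can be kept below \<open>g (Q n)\<close> and yet asymptotic to it. Any rational \<open>p / q\<close> outside
  the sequence is at distance at least \<open>1 / (8 q\<^sup>2)\<close> from \<open>\<theta>\<close>, which eventually exceeds \<open>g q\<close>.
\<close>

section \<open>Separation of fractions and Bezout successors\<close>

lemma distinct_fractions_apart:
  fixes p q a b :: int
  assumes "q > 0" "b > 0" "real_of_int p / real_of_int q \<noteq> real_of_int a / real_of_int b"
  shows "\<bar>real_of_int p / real_of_int q - real_of_int a / real_of_int b\<bar>
           \<ge> 1 / (real_of_int q * real_of_int b)"
proof -
  have "p * b \<noteq> a * q"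
  proof
    assume "p * b = a * q"
    then have "real_of_int p * real_of_int b = real_of_int a * real_of_int q"
      by (metis of_int_mult)
    with assms show False by (simp add: field_simps)
  qed
  then have "\<bar>p * b - a * q\<bar> \<ge> 1" by linarith
  then have "real_of_int \<bar>p * b - a * q\<bar> \<ge> 1" by linarith
  then have *: "\<bar>real_of_int p * real_of_int b - real_of_int a * real_of_int q\<bar> \<ge> 1"
    by simp
  have "real_of_int p / real_of_int q - real_of_int a / real_of_int b
      = (real_of_int p * real_of_int b - real_of_int a * real_of_int q)
          / (real_of_int q * real_of_int b)"
    using assms by (simp add: field_simps)
  then show ?thesis
    using * assms by (simp add: abs_mult divide_right_mono)
qed

text \<open>From a Bezout relation \<open>u * p + v * q = 1\<close>, every pair
  \<open>(v + k * p, k * q - u)\<close> solves the determinant equation. Its second entries run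
  through a full residue class modulo \<open>q\<close>, so one of them lies in any half-open
  interval of length \<open>q\<close>.\<close>

lemma unit_determinant_successor:
  fixes p q :: int and X :: real
  assumes "coprime p q" "q > 0"
  obtains p' q' :: int where "p' * q - p * q' = 1" "X < real_of_int q'"
    "real_of_int q' \<le> X + real_of_int q"
proof -
  obtain u v where uv: "u * p + v * q = 1"
    using assms(1) by (metis bezout_int coprime_imp_gcd_eq_1)
  define k where "k = \<lfloor>(X + real_of_int u) / real_of_int q\<rfloor> + 1"
  have qp: "real_of_int q > 0" using assms by simp
  have "real_of_int k - 1 \<le> (X + real_of_int u) / real_of_int q"
    and "(X + real_of_int u) / real_of_int q < real_of_int k"
    unfolding k_def by linarith+
  then have "(real_of_int k - 1) * real_of_int q \<le> X + real_of_int u"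
    and "X + real_of_int u < real_of_int k * real_of_int q"
    using qp by (simp_all add: field_simps)
  then have "X < real_of_int (k * q - u)" "real_of_int (k * q - u) \<le> X + real_of_int q"
    by (simp_all add: algebra_simps)
  moreover have "(v + k * p) * q - p * (k * q - u) = 1"
    using uv by (simp add: algebra_simps)
  ultimately show thesis using that by blast
qed

section \<open>Chains of fractions with consecutive determinants 1, and their limits\<close>

text \<open>Dependent choice iterates the Bezout step from \<open>1 / N\<close>; the lower bound on
  \<open>X\<close> keeps all denominators in the range where \<open>X\<close> is controlled. The
  window is shifted by \<open>Q n\<close> because the limit's error is bounded through
  \<open>Q (Suc n) - Q n\<close>, which then still exceeds \<open>X (Q n)\<close>.\<close>

lemma exists_fraction_chain:
  fixes X :: "int \<Rightarrow> real" and N :: int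
  assumes "N > 0" and X: "\<And>q. q \<ge> N \<Longrightarrow> X q \<ge> real_of_int q"
  obtains P Q :: "nat \<Rightarrow> int" where
    "\<And>n. coprime (P n) (Q n)"
    "\<And>n. Q n \<ge> N"
    "\<And>n. P (Suc n) * Q n - P n * Q (Suc n) = 1"
    "\<And>n. X (Q n) + real_of_int (Q n) < real_of_int (Q (Suc n))"
    "\<And>n. real_of_int (Q (Suc n)) \<le> X (Q n) + 2 * real_of_int (Q n)"
proof -
  define A where "A = (\<lambda>s :: int \<times> int. snd s \<ge> N \<and> coprime (fst s) (snd s))"
  define R where "R = (\<lambda>s t :: int \<times> int. fst t * snd s - fst s * snd t = 1 \<and>
    X (snd s) + real_of_int (snd s) < real_of_int (snd t) \<and>
    real_of_int (snd t) \<le> X (snd s) + 2 * real_of_int (snd s))"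
  have "\<exists>t. A t \<and> R s t" if s: "A s" for s
  proof -
    have s': "coprime (fst s) (snd s)" "snd s > 0" "snd s \<ge> N"
      using s assms(1) by (auto simp: A_def)
    obtain p' q' where pq: "p' * snd s - fst s * q' = 1"
      "X (snd s) + real_of_int (snd s) < real_of_int q'"
      "real_of_int q' \<le> X (snd s) + real_of_int (snd s) + real_of_int (snd s)"
      using unit_determinant_successor[OF s'(1,2)] by blast
    have "coprime p' q'"
    proof (rule coprimeI)
      fix c assume "c dvd p'" "c dvd q'"
      then have "c dvd p' * snd s - fst s * q'" by simp
      then show "is_unit c" using pq(1) by simp
    qed
    moreover have "q' \<ge> N"
      using X[OF s'(3)] pq(2) s'(2,3) by linarith
    ultimately have "A (p', q') \<and> R s (p', q')"
      using pq by (auto simp: A_def R_def)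
    then show ?thesis by blast
  qed
  moreover have "A (1, N)" by (simp add: A_def)
  ultimately obtain F where F: "\<And>n. A (F n)" "\<And>n. R (F n) (F (Suc n))"
    using dependent_nat_choice[of "\<lambda>_. A" "\<lambda>_. R"] by blast
  show thesis
    by (rule that[of "fst \<circ> F" "snd \<circ> F"]) (use F in \<open>auto simp: A_def R_def\<close>)
qed

text \<open>Consecutive fractions differ by \<open>1 / (Q n * Q (Suc n))\<close>, so they increase.
  Adding the claimed error bound to each gives a decreasing sequence of upper bounds, and the limit
  is trapped in between.\<close>

lemma fraction_chain_limit:
  fixes P Q :: "nat \<Rightarrow> int"
  assumes pos: "\<And>n. Q n > 0"
    and det: "\<And>n. P (Suc n) * Q n - P n * Q (Suc n) = 1"
    and grow: "\<And>n. 2 * Q n < Q (Suc n)"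
  obtains \<theta> :: real where
    "\<And>n. 1 / (real_of_int (Q n) * real_of_int (Q (Suc n)))
            < \<theta> - real_of_int (P n) / real_of_int (Q n)"
    "\<And>n. \<theta> - real_of_int (P n) / real_of_int (Q n)
            \<le> 1 / (real_of_int (Q n) * (real_of_int (Q (Suc n)) - real_of_int (Q n)))"
proof -
  define s where "s = (\<lambda>n. real_of_int (P n) / real_of_int (Q n))"
  define q where "q = (\<lambda>n. real_of_int (Q n))"
  define u where "u = (\<lambda>n. s n + 1 / (q n * (q (Suc n) - q n)))"
  have qpos: "q n > 0" for n using pos by (simp add: q_def)
  have qgrow: "2 * q n < q (Suc n)" for n
    unfolding q_def using grow[of n] by linarith
  have qgap: "q (Suc n) - q n > 0" for n using qgrow[of n] qpos[of n] by linarith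
  have s_Suc: "s (Suc n) = s n + 1 / (q n * q (Suc n))" for n
  proof -
    have "real_of_int (P (Suc n)) * q n - real_of_int (P n) * q (Suc n) = 1"
      unfolding q_def using arg_cong[OF det[of n], of real_of_int] by simp
    then show ?thesis
      using qpos[of n] qpos[of "Suc n"] unfolding s_def q_def[symmetric]
      by (simp add: field_simps q_def)
  qed
  have s_less: "s n < s (Suc n)" for n
    using s_Suc qpos by simp
  have u_Suc: "u (Suc n) \<le> u n" for n
  proof -
    \<comment> \<open>Since denominators more than double, the gap
      \<open>q (Suc (Suc n)) - q (Suc n)\<close> exceeds \<open>q (Suc n)\<close>, hence also the
      previous gap. The equality that follows is a partial fraction identity.\<close>
    have "1 / (q (Suc n) * (q (Suc (Suc n)) - q (Suc n)))
            \<le> 1 / (q (Suc n) * (q (Suc n) - q n))"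
      using qgrow[of "Suc n"] qpos[of n] qpos[of "Suc n"] qgap[of n]
      by (intro divide_left_mono mult_left_mono mult_pos_pos) auto
    also have "\<dots> = 1 / (q n * (q (Suc n) - q n)) - 1 / (q n * q (Suc n))"
      using qpos[of n] qpos[of "Suc n"] qgap[of n] by (simp add: divide_simps)
    finally show ?thesis unfolding u_def s_Suc by simp
  qed
  have s_inc: "incseq s" using s_less by (intro incseq_SucI) (simp add: less_imp_le)
  have u_dec: "decseq u" using u_Suc by (intro decseq_SucI)
  have su: "s n \<le> u n" for n unfolding u_def using qpos qgap by (simp add: less_imp_le)
  have le: "s n \<le> u m" for m n
    using incseqD[OF s_inc, of n "max m n"] su[of "max m n"] decseqD[OF u_dec, of m "max m n"]
    by simp
  obtain \<theta> where lim: "s \<longlonglongrightarrow> \<theta>" and above: "\<And>n. s n \<le> \<theta>"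
    using incseq_convergent[OF s_inc, of "u 0"] le by blast
  have upper: "\<theta> \<le> u n" for n
    using lim le by (intro LIMSEQ_le_const2) auto
  show thesis
  proof
    fix n
    \<comment> \<open>Going one term further in the increasing sequence makes the inequality
      strict.\<close>
    have "s (Suc n) < \<theta>" using s_less[of "Suc n"] above[of "Suc (Suc n)"] by linarith
    then show "1 / (real_of_int (Q n) * real_of_int (Q (Suc n)))
            < \<theta> - real_of_int (P n) / real_of_int (Q n)"
      using s_Suc[of n] by (simp add: s_def q_def)
    show "\<theta> - real_of_int (P n) / real_of_int (Q n)
            \<le> 1 / (real_of_int (Q n) * (real_of_int (Q (Suc n)) - real_of_int (Q n)))"
      using upper[of n] by (simp add: u_def s_def q_def)
  qed
qed

text \<open>A rational with denominator \<open>b\<close> stays at distance at least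
  \<open>1 / (b * q)\<close> from every other fraction with denominator \<open>q\<close>, which
  contradicts the hypothesis for \<open>C = b\<close>.\<close>

lemma irrational_if_approximated:
  fixes \<theta> :: real
  assumes "\<And>C. \<exists>p q :: int. q > 0 \<and> \<theta> \<noteq> real_of_int p / real_of_int q \<and>
    C * real_of_int q * \<bar>\<theta> - real_of_int p / real_of_int q\<bar> < 1"
  shows "\<theta> \<notin> \<rat>"
proof
  assume "\<theta> \<in> \<rat>"
  then obtain a b :: int where b: "b > 0" and \<theta>: "\<theta> = real_of_int a / real_of_int b"
    by (metis Rats_cases')
  obtain p q :: int where q: "q > 0" and ne: "\<theta> \<noteq> real_of_int p / real_of_int q"
    and less: "real_of_int b * real_of_int q * \<bar>\<theta> - real_of_int p / real_of_int q\<bar> < 1"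
    using assms by blast
  have "1 / (real_of_int b * real_of_int q) \<le> \<bar>\<theta> - real_of_int p / real_of_int q\<bar>"
    using distinct_fractions_apart[OF b q] ne \<theta> by simp
  with less b q show False by (simp add: field_simps)
qed

section \<open>Numbers approximable exactly to a given order\<close>

text \<open>Isolates what concerns a single function \<open>g\<close>, before the parameter of the
  measure enters. The lower bound holds for every constant \<open>c < 1\<close>, so it can meet
  whatever constant the contraction hypothesis on the measure supplies.\<close>

lemma exists_exact_order:
  fixes g :: "real \<Rightarrow> real"
  assumes g_pos: "\<And>x. x \<ge> 1 \<Longrightarrow> g x > 0"
    and g_mono: "\<And>x y. 1 \<le> x \<Longrightarrow> x \<le> y \<Longrightarrow> g y \<le> g x"
    and g_small: "g \<in> o[at_top](\<lambda>x. x powr (-2))"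
  obtains \<theta> :: real where "\<theta> \<notin> \<rat>" "approximable_to_order \<theta> g"
    "\<And>c. c < 1 \<Longrightarrow> \<exists>q0::int. q0 > 0 \<and> (\<forall>p q :: int. q \<ge> q0 \<longrightarrow>
       c * g (real_of_int q) \<le> \<bar>\<theta> - real_of_int p / real_of_int q\<bar>)"
proof -
  have small: "\<exists>N::int. N > 0 \<and> (\<forall>x \<ge> real_of_int N. x\<^sup>2 * g x \<le> c)" if "c > 0" for c :: real
  proof -
    have "\<forall>\<^sub>F x in at_top. norm (g x) \<le> c * norm (x powr (-2))"
      using landau_o.smallD[OF g_small that] .
    then obtain M where M: "\<And>x. x \<ge> M \<Longrightarrow> norm (g x) \<le> c * norm (x powr (-2))"
      by (auto simp: eventually_at_top_linorder)
    have "x\<^sup>2 * g x \<le> c" if x: "x \<ge> real_of_int (max 1 \<lceil>M\<rceil>)" for x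
    proof -
      have "x \<ge> 1" "x \<ge> M" using x by linarith+
      then have "g x \<le> c / x\<^sup>2"
        using M[of x] g_pos[of x] by (simp add: powr_minus divide_inverse)
      then show ?thesis using \<open>x \<ge> 1\<close> by (simp add: field_simps)
    qed
    then show ?thesis by (intro exI[of _ "max 1 \<lceil>M\<rceil>"]) auto
  qed
  obtain N :: int where N: "N > 0" "\<And>x. x \<ge> real_of_int N \<Longrightarrow> x\<^sup>2 * g x \<le> 1"
    using small[of 1] by auto
  \<comment> \<open>The ideal next denominator: \<open>1 / (q * X q) = g q\<close>. The bound 1 in
    the choice of \<open>N\<close> amounts to \<open>X q \<ge> q\<close>.\<close>
  define X where "X = (\<lambda>q::int. 1 / (real_of_int q * g (real_of_int q)))"
  have X_ge: "X q \<ge> real_of_int q" if "q \<ge> N" for q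
  proof -
    have "real_of_int q > 0" "g (real_of_int q) > 0" "(real_of_int q)\<^sup>2 * g (real_of_int q) \<le> 1"
      using that N g_pos[of "real_of_int q"] by auto
    then show ?thesis by (simp add: X_def field_simps power2_eq_square)
  qed
  obtain P Q :: "nat \<Rightarrow> int" where cop: "\<And>n. coprime (P n) (Q n)"
    and QN: "\<And>n. Q n \<ge> N"
    and det: "\<And>n. P (Suc n) * Q n - P n * Q (Suc n) = 1"
    and Q_lower: "\<And>n. X (Q n) + real_of_int (Q n) < real_of_int (Q (Suc n))"
    and Q_upper: "\<And>n. real_of_int (Q (Suc n)) \<le> X (Q n) + 2 * real_of_int (Q n)"
    by (rule exists_fraction_chain[OF N(1) X_ge]) (assumption, rule that)
  have Q_pos: "Q n > 0" for n using QN[of n] N(1) by linarith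
  have Q_grow: "2 * Q n < Q (Suc n)" for n
    using X_ge[OF QN[of n]] Q_lower[of n] by linarith
  obtain \<theta> where \<theta>_lower: "\<And>n. 1 / (real_of_int (Q n) * real_of_int (Q (Suc n)))
            < \<theta> - real_of_int (P n) / real_of_int (Q n)"
    and \<theta>_upper: "\<And>n. \<theta> - real_of_int (P n) / real_of_int (Q n)
            \<le> 1 / (real_of_int (Q n) * (real_of_int (Q (Suc n)) - real_of_int (Q n)))"
    by (rule fraction_chain_limit[of Q P, OF Q_pos det Q_grow]) (rule that)
  define e where "e = (\<lambda>n. \<theta> - real_of_int (P n) / real_of_int (Q n))"
  have e_pos: "e n > 0" for n
  proof -
    have "0 < 1 / (real_of_int (Q n) * real_of_int (Q (Suc n)))"
      using Q_pos by simp
    then show ?thesis using \<theta>_lower[of n] unfolding e_def by linarith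
  qed
  have Qr: "real_of_int (Q n) \<ge> 1" for n using Q_pos[of n] by simp
  have Q_Suc: "Q n < Q (Suc n)" for n using Q_grow[of n] Q_pos[of n] by linarith
  then have Q_mono: "strict_mono Q" by (simp add: strict_mono_Suc_iff)
  have Q_unbounded: "\<exists>n. Q n > k" for k
  proof -
    have "Q n > int n" for n
    proof (induction n)
      case (Suc n)
      then show ?case using Q_Suc[of n] by simp
    qed (use Q_pos[of 0] in simp)
    then have "Q (nat k) > int (nat k)" .
    then show ?thesis by (intro exI[of _ "nat k"]) linarith
  qed
  have e_less: "e n < g (real_of_int (Q n))" for n
  proof -
    have g: "g (real_of_int (Q n)) > 0" using g_pos[OF Qr] .
    have "X (Q n) < real_of_int (Q (Suc n)) - real_of_int (Q n)"
      using Q_lower[of n] by linarith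
    moreover have "X (Q n) > 0" using g Q_pos[of n] by (simp add: X_def)
    ultimately have "1 / (real_of_int (Q n) * (real_of_int (Q (Suc n)) - real_of_int (Q n)))
        < 1 / (real_of_int (Q n) * X (Q n))"
      using Q_pos[of n] by (intro divide_strict_left_mono mult_strict_left_mono mult_pos_pos) auto
    also have "\<dots> = g (real_of_int (Q n))"
      using Q_pos[of n] g by (simp add: X_def)
    finally show ?thesis using \<theta>_upper[of n] by (simp add: e_def)
  qed
  \<comment> \<open>The upper end \<open>X (Q n) + 2 * Q n\<close> of the window costs only this
    denominator, which tends to 1 because \<open>x^2 * g x\<close> tends to 0.\<close>
  have e_greater: "g (real_of_int (Q n)) / (1 + 2 * ((real_of_int (Q n))\<^sup>2 * g (real_of_int (Q n)))) \<le> e n" for n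
  proof -
    define x where "x = real_of_int (Q n)"
    have x: "x > 0" "g x > 0" using Qr[of n] g_pos[of x] by (auto simp: x_def)
    have "g x / (1 + 2 * (x\<^sup>2 * g x)) = 1 / (x * (X (Q n) + 2 * x))"
      using x by (simp add: X_def x_def[symmetric] divide_simps power2_eq_square)
    also have "\<dots> \<le> 1 / (x * real_of_int (Q (Suc n)))"
      using Q_upper[of n] x Q_pos[of "Suc n"] 
      by (intro divide_left_mono mult_left_mono mult_pos_pos) (auto simp: x_def)
    also have "\<dots> \<le> e n" using \<theta>_lower[of n] by (simp add: e_def x_def)
    finally show ?thesis by (simp add: x_def)
  qed
  have e_le: "e n \<le> 2 / (real_of_int (Q n) * real_of_int (Q (Suc n)))" for n
  proof -
    have "real_of_int (Q (Suc n)) / 2 \<le> real_of_int (Q (Suc n)) - real_of_int (Q n)"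
      using Q_grow[of n] by linarith
    then have "1 / (real_of_int (Q n) * (real_of_int (Q (Suc n)) - real_of_int (Q n)))
        \<le> 1 / (real_of_int (Q n) * (real_of_int (Q (Suc n)) / 2))"
      using Q_pos[of n] Q_pos[of "Suc n"]
      by (intro divide_left_mono mult_left_mono mult_pos_pos) auto
    then show ?thesis using \<theta>_upper[of n] by (simp add: e_def)
  qed
  \<comment> \<open>The index \<open>m\<close> is carried along so that a coincidence with the chain
    occurs only at late terms, where \<open>e n\<close> is already close to
    \<open>g (Q n)\<close>.\<close>
  have dichotomy: "\<exists>n\<ge>m. (real_of_int p / real_of_int q = real_of_int (P n) / real_of_int (Q n) \<and> Q n \<le> q)
      \<or> 1 / (8 * (real_of_int q)\<^sup>2) \<le> \<bar>\<theta> - real_of_int p / real_of_int q\<bar>"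
    if q: "q \<ge> Q m" for m and p q :: int
  proof -
    have qp: "q > 0" using q Q_pos[of m] by linarith
    \<comment> \<open>The predecessor \<open>n\<close> of \<open>k\<close> satisfies
      \<open>Q n \<le> 4 * q < Q (Suc n)\<close>. The factor 4 makes \<open>e n\<close> at most half
      the separation \<open>1 / (q * Q n)\<close>; the remaining half is at least
      \<open>1 / (8 * q^2)\<close>.\<close>
    define k where "k = (LEAST k. Q k > 4 * q)"
    have k: "Q k > 4 * q" unfolding k_def using Q_unbounded by (rule LeastI_ex)
    have "k > m"
    proof (rule ccontr)
      assume "\<not> k > m"
      then have "Q k \<le> Q m" using Q_mono by (simp add: strict_mono_less_eq)
      with k q qp show False by linarith
    qed
    then obtain n where n: "k = Suc n" "n \<ge> m" by (cases k) auto
    have Qn: "Q n \<le> 4 * q"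
      using not_less_Least[of n "\<lambda>k. Q k > 4 * q"] n(1) k_def by linarith
    have "1 / (8 * (real_of_int q)\<^sup>2) \<le> \<bar>\<theta> - real_of_int p / real_of_int q\<bar>"
      if ne: "real_of_int p / real_of_int q \<noteq> real_of_int (P n) / real_of_int (Q n)"
    proof -
      have "1 / (real_of_int q * real_of_int (Q n))
          \<le> \<bar>real_of_int p / real_of_int q - real_of_int (P n) / real_of_int (Q n)\<bar>"
        using distinct_fractions_apart[OF qp Q_pos ne] .
      also have "\<dots> \<le> \<bar>\<theta> - real_of_int p / real_of_int q\<bar> + e n"
        using e_pos[of n] unfolding e_def by linarith
      finally have 1: "1 / (real_of_int q * real_of_int (Q n)) - e n \<le> \<bar>\<theta> - real_of_int p / real_of_int q\<bar>"
        by linarith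
      have "e n \<le> 2 / (real_of_int (Q n) * real_of_int (Q (Suc n)))" by (rule e_le)
      also have "\<dots> \<le> 2 / (real_of_int (Q n) * (4 * real_of_int q))"
        using k n(1) qp Q_pos[of n] Q_pos[of "Suc n"]
        by (intro divide_left_mono mult_left_mono mult_pos_pos) auto
      finally have "1 / (2 * (real_of_int q * real_of_int (Q n)))
          \<le> 1 / (real_of_int q * real_of_int (Q n)) - e n"
        using qp Q_pos[of n] by (simp add: field_simps)
      moreover have "1 / (8 * (real_of_int q)\<^sup>2) \<le> 1 / (2 * (real_of_int q * real_of_int (Q n)))"
      proof -
        have "real_of_int (Q n) \<le> 4 * real_of_int q" using Qn by linarith
        then have "real_of_int q * real_of_int (Q n) \<le> real_of_int q * (4 * real_of_int q)"
          using qp by (intro mult_left_mono) auto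
        then show ?thesis
          using qp Q_pos[of n] by (intro divide_left_mono mult_pos_pos) (auto simp: power2_eq_square)
      qed
      ultimately show ?thesis using 1 by linarith
    qed
    \<comment> \<open>Here \<open>p / q\<close> may be unreduced, but \<open>P n / Q n\<close> is in
      lowest terms, so \<open>Q n\<close> divides \<open>q\<close>.\<close>
    moreover have "Q n \<le> q"
      if eq: "real_of_int p / real_of_int q = real_of_int (P n) / real_of_int (Q n)"
    proof -
      have "real_of_int p * real_of_int (Q n) = real_of_int (P n) * real_of_int q"
        using eq qp Q_pos[of n] by (simp add: field_simps)
      then have "p * Q n = P n * q" by (metis of_int_eq_iff of_int_mult)
      then have "Q n dvd P n * q" by (metis dvd_triv_right)
      then have "Q n dvd q"
        using cop[of n] by (simp add: coprime_commute coprime_dvd_mult_right_iff)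
      then show ?thesis using qp by (rule zdvd_imp_le)
    qed
    ultimately show ?thesis using n(2) by blast
  qed
  show thesis
  proof
    show "\<theta> \<notin> \<rat>"
    proof (rule irrational_if_approximated)
      fix C :: real
      obtain n where "Q n > \<lceil>2 * C\<rceil>" using Q_unbounded by blast
      then have "2 * C < real_of_int (Q (Suc n))"
        using Q_grow[of n] Q_pos[of n] by linarith
      then have C: "2 * C / real_of_int (Q (Suc n)) < 1"
        using Q_pos[of "Suc n"] by simp
      \<comment> \<open>By \<open>e_le\<close>, \<open>Q n * e n\<close> is at most
        \<open>2 / Q (Suc n)\<close>, which becomes arbitrarily small.\<close>
      have "C * real_of_int (Q n) * e n < 1"
      proof (cases "C > 0")
        case True
        then have "C * real_of_int (Q n) * e n
            \<le> C * real_of_int (Q n) * (2 / (real_of_int (Q n) * real_of_int (Q (Suc n))))"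
          using e_le[of n] Q_pos[of n] by (intro mult_left_mono) auto
        also have "\<dots> = 2 * C / real_of_int (Q (Suc n))"
          using Q_pos[of n] by simp
        finally show ?thesis using C by linarith
      next
        case False
        then have "C * real_of_int (Q n) * e n \<le> 0"
          using Q_pos[of n] e_pos[of n] by (intro mult_nonpos_nonneg) auto
        then show ?thesis by linarith
      qed
      then have "Q n > 0 \<and> \<theta> \<noteq> real_of_int (P n) / real_of_int (Q n) \<and>
          C * real_of_int (Q n) * \<bar>\<theta> - real_of_int (P n) / real_of_int (Q n)\<bar> < 1"
        using Q_pos[of n] e_pos[of n] by (auto simp: e_def)
      then show "\<exists>p q :: int. q > 0 \<and> \<theta> \<noteq> real_of_int p / real_of_int q \<and>
          C * real_of_int q * \<bar>\<theta> - real_of_int p / real_of_int q\<bar> < 1" by blast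
    qed
    show "approximable_to_order \<theta> g"
      unfolding approximable_to_order_def
    proof (intro allI impI)
      fix C :: real
      obtain n where "Q n > \<lceil>C\<rceil>" using Q_unbounded by blast
      then have "real_of_int (Q n) > C" by linarith
      moreover have "\<bar>\<theta> - real_of_int (P n) / real_of_int (Q n)\<bar> < g (real_of_int (Q n))"
        using e_less[of n] e_pos[of n] by (simp add: e_def)
      ultimately show "\<exists>p q :: int. real_of_int q > C \<and>
          \<bar>\<theta> - real_of_int p / real_of_int q\<bar> < g (real_of_int q)" by blast
    qed
    fix c :: real assume "c < 1"
    \<comment> \<open>\<open>c\<close> may be zero or negative; the larger \<open>d\<close> is
      positive, so \<open>1 / d\<close> is usable, and still below 1.\<close>
    define d where "d = max c (1/2)"
    have d: "0 < d" "d < 1" "c \<le> d" using \<open>c < 1\<close> by (auto simp: d_def)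
    \<comment> \<open>The bound \<open>1/8\<close> serves fractions outside the chain, as it gives
      \<open>g q \<le> 1 / (8 * q^2)\<close>. The bound \<open>(1/d - 1) / 2\<close> serves chain
      fractions, as it makes the denominator in \<open>e_greater\<close> at most
      \<open>1 / d\<close>.\<close>
    obtain K :: int where K: "K > 0" "\<And>x. x \<ge> real_of_int K \<Longrightarrow> x\<^sup>2 * g x \<le> min (1/8) ((1/d - 1) / 2)"
      using small[of "min (1/8) ((1/d - 1) / 2)"] d by auto
    obtain m where m: "Q m > K" using Q_unbounded by blast
    have "c * g (real_of_int q) \<le> \<bar>\<theta> - real_of_int p / real_of_int q\<bar>"
      if q: "q \<ge> Q m" for p q :: int
    proof -
      have qp: "real_of_int q \<ge> 1" using q Q_pos[of m] by linarith
      have gq: "g (real_of_int q) > 0" using g_pos[OF qp] .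
      have cd: "c * g (real_of_int q) \<le> d * g (real_of_int q)"
        using d(3) gq by simp
      obtain n where n: "n \<ge> m" and
        cases: "(real_of_int p / real_of_int q = real_of_int (P n) / real_of_int (Q n) \<and> Q n \<le> q)
          \<or> 1 / (8 * (real_of_int q)\<^sup>2) \<le> \<bar>\<theta> - real_of_int p / real_of_int q\<bar>"
        using dichotomy[OF q] by blast
      from cases show ?thesis
      proof (elim disjE conjE)
        assume eq: "real_of_int p / real_of_int q = real_of_int (P n) / real_of_int (Q n)"
          and le: "Q n \<le> q"
        define x where "x = real_of_int (Q n)"
        have "Q m \<le> Q n" using n Q_mono by (simp add: strict_mono_less_eq)
        then have "x \<ge> real_of_int K" using m by (simp add: x_def)
        then have "x\<^sup>2 * g x \<le> (1/d - 1) / 2" using K(2)[of x] by simp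
        then have bound: "1 + 2 * (x\<^sup>2 * g x) \<le> 1 / d"
          by (simp only: le_divide_eq_numeral1 algebra_simps)
        have gx: "g x > 0" using g_pos[of x] Qr[of n] by (simp add: x_def)
        then have pos: "1 + 2 * (x\<^sup>2 * g x) > 0"
          by (simp add: add_pos_nonneg)
        \<comment> \<open>Monotonicity of \<open>g\<close> passes from the reduced denominator
          \<open>Q n\<close> to a multiple \<open>q\<close>.\<close>
        have "d * g (real_of_int q) \<le> d * g x"
          using d(1) g_mono[of x "real_of_int q"] le Qr[of n] by (simp add: x_def)
        also have "\<dots> = g x / (1 / d)" by simp
        also have "\<dots> \<le> g x / (1 + 2 * (x\<^sup>2 * g x))"
          using bound pos gx d(1) by (intro divide_left_mono mult_pos_pos) auto
        also have "\<dots> \<le> e n" using e_greater[of n] by (simp add: x_def)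
        also have "\<dots> \<le> \<bar>\<theta> - real_of_int p / real_of_int q\<bar>"
          unfolding eq by (simp add: e_def)
        finally show ?thesis using cd by linarith
      next
        assume far: "1 / (8 * (real_of_int q)\<^sup>2) \<le> \<bar>\<theta> - real_of_int p / real_of_int q\<bar>"
        have "real_of_int q \<ge> real_of_int K" using q m by simp
        then have "(real_of_int q)\<^sup>2 * g (real_of_int q) \<le> 1/8" using K(2) by fastforce
        then have "g (real_of_int q) \<le> 1 / (8 * (real_of_int q)\<^sup>2)"
          using qp by (simp add: field_simps)
        moreover have "c * g (real_of_int q) \<le> g (real_of_int q)"
          using \<open>c < 1\<close> gq by simp
        ultimately show ?thesis using far by linarith
      qed
    qed
    then show "\<exists>q0::int. q0 > 0 \<and> (\<forall>p q :: int. q \<ge> q0 \<longrightarrow>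
       c * g (real_of_int q) \<le> \<bar>\<theta> - real_of_int p / real_of_int q\<bar>)"
      using Q_pos[of m] by blast
  qed
qed

section \<open>From exact order of approximation to the irrationality measure\<close>

theorem theorem3:
  fixes f :: "real \<Rightarrow> real \<Rightarrow> real" and l :: real
  assumes "irrationality_measure f"
    and "l > 0"
    and "(\<lambda>x. f x l) \<in> o[at_top](\<lambda>x. x powr (-2))"
    and "\<forall>\<epsilon>>0. \<exists>c. 0 < c \<and> c < 1 \<and> (\<forall>\<^sub>F x in at_top. f x (l + \<epsilon>) < c * f x l)"
  shows "\<exists>\<theta>::real. \<theta> \<notin> \<rat> \<and> has_irrationality_measure \<theta> f l
           \<and> approximable_to_order \<theta> (\<lambda>x. f x l)"
proof -
  have pos: "f x l > 0" if "x \<ge> 1" for x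
    using assms(1,2) that by (auto simp: irrationality_measure_def)
  have mono: "f y l \<le> f x l" if "1 \<le> x" "x \<le> y" for x y
  proof (cases "x = y")
    case False
    then have "f y l < f x l"
      using assms(1,2) that by (auto simp: irrationality_measure_def monotone_on_def)
    then show ?thesis by simp
  qed simp
  obtain \<theta> :: real where irr: "\<theta> \<notin> \<rat>" and app: "approximable_to_order \<theta> (\<lambda>x. f x l)"
    and far: "\<And>c. c < 1 \<Longrightarrow> \<exists>q0::int. q0 > 0 \<and> (\<forall>p q :: int. q \<ge> q0 \<longrightarrow>
       c * f (real_of_int q) l \<le> \<bar>\<theta> - real_of_int p / real_of_int q\<bar>)"
    using exists_exact_order[of "\<lambda>x. f x l"] pos mono assms(3) by blast
  have "l \<in> admissible_parameters f \<theta>"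
    unfolding admissible_parameters_def
  proof (intro CollectI conjI allI impI)
    fix \<epsilon> :: real assume "\<epsilon> > 0"
    \<comment> \<open>The contraction constant for this \<open>\<epsilon>\<close> is fed into
      \<open>far\<close>: eventually \<open>f q (l + \<epsilon>) < c * f q l\<close>, which is at
      most the distance to \<open>p / q\<close>.\<close>
    then obtain c where c: "c < 1" "\<forall>\<^sub>F x in at_top. f x (l + \<epsilon>) < c * f x l"
      using assms(4) by blast
    then obtain M where M: "\<And>x. x \<ge> M \<Longrightarrow> f x (l + \<epsilon>) < c * f x l"
      by (auto simp: eventually_at_top_linorder)
    obtain q0 :: int where q0: "q0 > 0" "\<And>p q :: int. q \<ge> q0 \<Longrightarrow>
       c * f (real_of_int q) l \<le> \<bar>\<theta> - real_of_int p / real_of_int q\<bar>"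
      using far[OF c(1)] by blast
    have "f (real_of_int q) (l + \<epsilon>) < \<bar>\<theta> - real_of_int p / real_of_int q\<bar>"
      if "q \<ge> max q0 \<lceil>M\<rceil>" for p q :: int
    proof -
      have "real_of_int q \<ge> M" "q \<ge> q0" using that by linarith+
      then show ?thesis using M[of "real_of_int q"] q0(2)[of q p] by linarith
    qed
    then show "\<exists>q0::int. q0 > 0 \<and> (\<forall>p q :: int. q \<ge> q0 \<longrightarrow>
        \<bar>\<theta> - real_of_int p / real_of_int q\<bar> > f (real_of_int q) (l + \<epsilon>))"
      using q0(1) by (intro exI[of _ "max q0 \<lceil>M\<rceil>"]) auto
  qed (fact assms(2))
  moreover have "l \<le> m" if m: "m \<in> admissible_parameters f \<theta>" for m
  proof (rule ccontr)
    assume "\<not> l \<le> m"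
    \<comment> \<open>Taking \<open>\<epsilon> = l - m\<close> in the admissibility of
      \<open>m\<close> gives a lower bound by \<open>f q l\<close> itself for all large
      \<open>q\<close>, contradicting approximability to that order.\<close>
    then have "l - m > 0" by simp
    with m obtain q0 :: int where q0: "q0 > 0" "\<And>p q :: int. q \<ge> q0 \<Longrightarrow>
        \<bar>\<theta> - real_of_int p / real_of_int q\<bar> > f (real_of_int q) (m + (l - m))"
      unfolding admissible_parameters_def by blast
    obtain p q :: int where "real_of_int q > real_of_int q0"
      "\<bar>\<theta> - real_of_int p / real_of_int q\<bar> < f (real_of_int q) l"
      using app q0(1) unfolding approximable_to_order_def by (metis of_int_0_less_iff)
    then show False using q0(2)[of q p] by simp
  qed
  ultimately show ?thesis
    using irr app by (auto simp: has_irrationality_measure_def)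
qed

end
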